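(* Let $p>1$ and $0<q\le1$. Let $y\in\mathcal{R}(A)$ and let $x^\dagger\neq0$ be the uniquely determined solution of $Ax=y$. Assume that $x^\dagger\in\mathcal{M}_{q,w}$ and that for all $k\in\operatorname{supp}(x^\dagger)$ there exists $f_k\in Y^*$ (fixed in what follows) such that $u_k=A^*f_k$. Let $\varphi_{q,w}$ be the concave index function $$\varphi_{q,w}(t):=2\inf_{n\in\mathbb{N}}\left(\sum_{k=n+1}^\infty w_k|\langle x^\dagger,u_k\rangle_X|^q+t^q\sum_{k\in S_n(x^\dagger)}w_k\|f_k\|_{Y^*}^q\right),\qquad S_n(x^\dagger)=\operatorname{supp}(x^\dagger)\cap\{1,\dots,n\}.$$ If the regularization parameter $\alpha_*=\alpha_*(\delta,y^\delta)$ is chosen according to the sequential discrepancy principle, then $$\mathcal{R}_{q,w}(x_{\alpha_*}^\delta-x^\dagger)=\mathcal{O}(\varphi_{q,w}(\delta))\qquad\text{as }\delta\to0.$$ Independent of the choice of $0<q\le1$ in the penalty one always has $$\|x_{\alpha_*}^\delta-x^\dagger\|_X\le\mathcal{R}_1(x_{\alpha_*}^\delta-x^\dagger)\le\left(\frac1{w_0}\mathcal{R}_{q,w}(x_{\alpha_*}^\delta-x^\dagger)\right)^{1/q}=\mathcal{O}\left(\varphi_{q,w}^{1/q}(\delta)\right)\qquad\text{as }\delta\to0.$$ If $x^\dagger$ is sparse (i.e. $\operatorname{supp}(x^\dagger)$ is finite), then $x^\dagger\in\mathcal{M}_{q,w}$ holds for all $q\in[0,1]$, and one gets a linear rate expressed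 by the estimate $$\varphi_{q,w}^{1/q}(\delta)\le C_{q,w}\,\delta,$$ but the constants $$C_{q,w}=\left(\sum_{k\in\operatorname{supp}(x^\dagger)}w_k\|f_k\|_{Y^*}^q\right)^{1/q}$$ tend to infinity as $q\to0$ whenever $\operatorname{supp}(x^\dagger)$ contains more than one element.
   Context: $X$ is an infinite-dimensional separable real Hilbert space, $Y$ is a Banach space with dual $Y^*$, and $A:X\to Y$ is a bounded injective linear operator with non-closed range $\mathcal{R}(A)$. Identifying $X$ with its dual, $A^*:Y^*\to X$ is defined by $\langle f,Ax\rangle_{Y^*\times Y}=\langle A^*f,x\rangle_X$ for all $x\in X$, $f\in Y^*$. $\{u_k\}_{k\in\mathbb{N}}$ ($\mathbb{N}=\{1,2,\dots\}$) is a fixed orthonormal basis of $X$ and $(w_k)_{k\in\mathbb{N}}$ are fixed weights with $0<w_0\le w_k$ for all $k\in\mathbb{N}$, for some constant $w_0$. Let $\operatorname{supp}(x)=\{k\in\mathbb{N}:\langle x,u_k\rangle_X\ne0\}$ and, for $0<q\le1$, $$\mathcal{R}_{q,w}(x)=\sum_{k=1}^\infty w_k|\langle x,u_k\rangle_X|^q,\qquad \mathcal{M}_{q,w}=\{x\in X:\mathcal{R}_{q,w}(x)<\infty\},\qquad \mathcal{R}_1(x)=\sum_{k=1}^\infty|\langle x,u_k\rangle_X|;$$ for $q=0$, $\mathcal{M}_{0,w}$ is the set of sparse elements, i.e. of all $x\in X$ with finite support. An index function is an increasing function $\varphi:(0,\infty)\to(0,\infty)$ with $\lim_{t\to+0}\varphi(t)=0$.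 For noisy data $y^\delta\in Y$ with $\|y-y^\delta\|_Y\le\delta$, $\delta>0$, and $\alpha>0$, $x_\alpha^\delta$ denotes a minimizer over $X$ of the Tikhonov functional $T_\alpha^\delta(x)=\frac1p\|Ax-y^\delta\|_Y^p+\alpha\mathcal{R}_{q,w}(x)$ with values in $[0,\infty]$ (minimizers exist for all $\alpha>0$ and $y^\delta\in Y$). Sequential discrepancy principle (SDP): for prescribed $0<\theta<1$, $\alpha_0>0$ and $\tau>1$, let $\Delta_\theta=\{\alpha_j:\alpha_j=\theta^j\alpha_0,\ j\in\mathbb{Z}\}$. Given $\delta>0$ and $y^\delta$, fix some selection of minimizers $x_\alpha^\delta$ of $T_\alpha^\delta$ for $\alpha\in\Delta_\theta$. An element $\alpha\in\Delta_\theta$ is chosen according to the SDP if $$\|Ax_\alpha^\delta-y^\delta\|_Y\le\tau\delta<\|Ax_{\alpha/\theta}^\delta-y^\delta\|_Y.$$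
   Formalization: The linear estimate is proved with 2^{1/q}C_{q,w} in place of C_{q,w}; C_{q,w}→∞ is proved when the weights over the support sum to more than 1 (false otherwise), and w_0^{-1/q}C_{q,w}→∞ for all weights; "increasing" means nondecreasing. *)

theory Defs
  imports "HOL-Analysis.Analysis"
begin

text \<open>
  The index set \<open>{1, 2, \<dots>}\<close> is \<open>{1..} :: nat set\<close>; values at the index \<open>0\<close> are never used.
  Infinite dimension and separability of the ambient space are consequences of the
  existence of an orthonormal basis indexed by \<open>{1..}\<close>.
\<close>

definition orthonormal_basis :: "(nat \<Rightarrow> 'a::real_inner) \<Rightarrow> bool" where
  "orthonormal_basis u \<longleftrightarrow>
     (\<forall>i\<ge>1. \<forall>j\<ge>1. u i \<bullet> u j = (if i = j then 1 else 0)) \<and> closure (span (u ` {1..})) = UNIV"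

definition supp :: "(nat \<Rightarrow> 'a::real_inner) \<Rightarrow> 'a \<Rightarrow> nat set" where
  "supp u x = {k \<in> {1..}. x \<bullet> u k \<noteq> 0}"

text \<open>
  The sums below take values in \<open>[0, \<infinity>]\<close>; in \<^typ>\<open>ennreal\<close> every infinite sum converges, so no
  summability side condition is needed.
\<close>

definition R_qw :: "(nat \<Rightarrow> 'a::real_inner) \<Rightarrow> (nat \<Rightarrow> real) \<Rightarrow> real \<Rightarrow> 'a \<Rightarrow> ennreal" where
  "R_qw u w q x = (\<Sum>\<^sub>\<infinity>k\<in>{1..}. ennreal (w k * \<bar>x \<bullet> u k\<bar> powr q))"

definition R_one :: "(nat \<Rightarrow> 'a::real_inner) \<Rightarrow> 'a \<Rightarrow> ennreal" where
  "R_one u x = (\<Sum>\<^sub>\<infinity>k\<in>{1..}. ennreal \<bar>x \<bullet> u k\<bar>)"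

definition M_qw :: "(nat \<Rightarrow> 'a::real_inner) \<Rightarrow> (nat \<Rightarrow> real) \<Rightarrow> real \<Rightarrow> 'a set" where
  "M_qw u w q = (if q = 0 then {x. finite (supp u x)} else {x. R_qw u w q x < \<infinity>})"

text \<open>Real powers on \<open>[0, \<infinity>]\<close> with \<open>\<infinity>\<close> raised to a positive exponent being \<open>\<infinity>\<close>.\<close>

definition ennreal_powr :: "ennreal \<Rightarrow> real \<Rightarrow> ennreal" where
  "ennreal_powr a r = (if a = \<infinity> then \<infinity> else ennreal (enn2real a powr r))"

text \<open>
  The adjoint as a map from the dual of the Banach space into the Hilbert space, the latter being
  identified with its own dual.
\<close>

definition dual_adjoint ::
    "('a::real_inner \<Rightarrow> 'b::real_normed_vector) \<Rightarrow> ('b \<Rightarrow>\<^sub>L real) \<Rightarrow> 'a" where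
  "dual_adjoint A f = (THE z. \<forall>x. blinfun_apply f (A x) = z \<bullet> x)"

lemma riesz_representation:
  fixes g :: "'a::{real_inner, complete_space} \<Rightarrow> real"
  assumes "bounded_linear g"
  shows "\<exists>z. \<forall>x. g x = z \<bullet> x"
proof -
  interpret g: bounded_linear g by fact
  define J where "J x = x \<bullet> x - 2 * g x" for x
  obtain K where K: "\<And>x. norm (g x) \<le> norm x * K"
    using g.bounded by blast
  have low: "J x \<ge> - (K^2)" for x
  proof -
    have "g x \<le> norm x * K" using K[of x] by simp
    moreover have "0 \<le> (norm x - K)^2" by simp
    ultimately show ?thesis
      unfolding J_def power2_norm_eq_inner[symmetric] by (simp add: power2_diff)
  qed
  define m where "m = Inf (range J)"
  have bdd: "bdd_below (range J)" using low by (auto simp: bdd_below_def)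
  have m_le: "m \<le> J x" for x unfolding m_def using bdd by (simp add: cInf_lower)
  have "\<exists>x. J x < m + 1 / real (Suc n)" for n
    using cInf_lessD[of "range J" "m + 1 / real (Suc n)"] by (auto simp: m_def)
  then obtain s where s: "\<And>n. J (s n) < m + 1 / real (Suc n)" by metis
  have par: "(norm (a - b))^2 \<le> 2 * (J a + J b - 2 * m)" for a b
  proof -
    have "J a + J b = 2 * J ((1/2) *\<^sub>R (a + b)) + (norm (a - b))^2 / 2"
      unfolding J_def power2_norm_eq_inner
      by (simp add: g.add g.scaleR inner_add inner_diff inner_commute field_simps)
    then show ?thesis using m_le[of "(1/2) *\<^sub>R (a + b)"] by simp
  qed
  have "Cauchy s"
  proof (rule metric_CauchyI)
    fix e :: real assume e: "e > 0"
    obtain N where N: "1 / real (Suc N) < e^2 / 4"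
      using e by (metis nat_approx_posE zero_less_divide_iff zero_less_numeral zero_less_power)
    have "dist (s i) (s j) < e" if "i \<ge> N" "j \<ge> N" for i j
    proof -
      have "J (s k) < m + e^2 / 4" if "k \<ge> N" for k
      proof -
        have "1 / real (Suc k) \<le> 1 / real (Suc N)" using that by (simp add: field_simps)
        then show ?thesis using s[of k] N by linarith
      qed
      from this[OF that(1)] this[OF that(2)] have "2 * (J (s i) + J (s j) - 2 * m) < e^2"
        by (simp add: field_simps)
      with par[of "s i" "s j"] have "(norm (s i - s j))^2 < e^2" by (rule order_le_less_trans)
      then show ?thesis using e by (simp add: dist_norm power2_less_imp_less)
    qed
    then show "\<exists>M. \<forall>i\<ge>M. \<forall>j\<ge>M. dist (s i) (s j) < e" by blast
  qed
  then have "convergent s" by (rule Cauchy_convergent)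
  then obtain z where z: "s \<longlonglongrightarrow> z" by (auto simp: convergent_def)
  have "(\<lambda>n. J (s n)) \<longlonglongrightarrow> J z"
    unfolding J_def by (intro tendsto_intros g.tendsto z)
  moreover have "(\<lambda>n. m + 1 / real (Suc n)) \<longlonglongrightarrow> m + 0"
    by (intro tendsto_intros LIMSEQ_Suc[OF lim_1_over_n])
  moreover have "\<exists>N. \<forall>n\<ge>N. J (s n) \<le> m + 1 / real (Suc n)"
    using s by (auto intro: less_imp_le)
  ultimately have "J z \<le> m + 0"
    by (rule LIMSEQ_le)
  then have "J z \<le> m" by simp
  have "g x = z \<bullet> x" for x
  proof -
    define c where "c = z \<bullet> x - g x"
    define t where "t = - c / (x \<bullet> x + 1)"
    have pos: "x \<bullet> x + 1 > 0" using inner_ge_zero[of x] by linarith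
    have "J (z + t *\<^sub>R x) = J z + 2 * t * c + t^2 * (x \<bullet> x)"
      unfolding J_def c_def
      by (simp add: g.add g.scaleR inner_add inner_commute algebra_simps power2_eq_square)
    then have "0 \<le> 2 * t * c + t^2 * (x \<bullet> x)"
      using m_le[of "z + t *\<^sub>R x"] \<open>J z \<le> m\<close> by linarith
    also have "\<dots> \<le> 2 * t * c + t^2 * (x \<bullet> x + 1)" by (simp add: algebra_simps)
    also have "t^2 * (x \<bullet> x + 1) = t * (t * (x \<bullet> x + 1))" by (simp add: power2_eq_square)
    also have "t * (x \<bullet> x + 1) = - c" using pos by (simp add: t_def)
    finally have "0 \<le> t * c" by (simp add: mult.commute)
    also have "t * c = - (c^2 / (x \<bullet> x + 1))" by (simp add: t_def power2_eq_square)
    finally have "c^2 / (x \<bullet> x + 1) \<le> 0" by simp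
    then have "c^2 \<le> 0" using pos by (simp add: divide_le_0_iff)
    then show ?thesis by (simp add: c_def)
  qed
  then show ?thesis by blast
qed

lemma dual_adjoint_works:
  fixes A :: "'a::{real_inner, complete_space} \<Rightarrow> 'b::real_normed_vector"
  assumes "bounded_linear A"
  shows "blinfun_apply f (A x) = dual_adjoint A f \<bullet> x"
proof -
  have "bounded_linear (\<lambda>x. blinfun_apply f (A x))"
    using assms by (rule blinfun.bounded_linear_right[THEN bounded_linear_compose])
  then obtain z where z: "\<forall>x. blinfun_apply f (A x) = z \<bullet> x"
    using riesz_representation by blast
  have "\<forall>x. blinfun_apply f (A x) = dual_adjoint A f \<bullet> x"
    unfolding dual_adjoint_def
  proof (rule theI)
    show "\<forall>x. blinfun_apply f (A x) = z \<bullet> x" by fact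
    fix z' assume "\<forall>x. blinfun_apply f (A x) = z' \<bullet> x"
    then have "\<forall>x. (z' - z) \<bullet> x = 0" using z by (simp add: inner_diff_left)
    then show "z' = z" by (metis inner_eq_zero_iff right_minus_eq)
  qed
  then show ?thesis ..
qed

definition tikhonov ::
    "('a::real_inner \<Rightarrow> 'b::real_normed_vector) \<Rightarrow> (nat \<Rightarrow> 'a) \<Rightarrow> (nat \<Rightarrow> real) \<Rightarrow> real \<Rightarrow> real \<Rightarrow>
     'b \<Rightarrow> real \<Rightarrow> 'a \<Rightarrow> ennreal" where
  "tikhonov A u w p q yd \<alpha> x =
     ennreal (1 / p * norm (A x - yd) powr p) + ennreal \<alpha> * R_qw u w q x"

definition sdp_grid :: "real \<Rightarrow> real \<Rightarrow> real set" where
  "sdp_grid \<theta> \<alpha>0 = {\<theta> powi j * \<alpha>0 | j. j \<in> (UNIV :: int set)}"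

definition minimizer_selection ::
    "('a::real_inner \<Rightarrow> 'b::real_normed_vector) \<Rightarrow> (nat \<Rightarrow> 'a) \<Rightarrow> (nat \<Rightarrow> real) \<Rightarrow> real \<Rightarrow> real \<Rightarrow>
     'b \<Rightarrow> real set \<Rightarrow> (real \<Rightarrow> 'a) \<Rightarrow> bool" where
  "minimizer_selection A u w p q yd G xs \<longleftrightarrow>
     (\<forall>\<alpha>\<in>G. is_arg_min (tikhonov A u w p q yd \<alpha>) (\<lambda>_. True) (xs \<alpha>))"

definition sdp_choice ::
    "('a::real_inner \<Rightarrow> 'b::real_normed_vector) \<Rightarrow> real \<Rightarrow> real \<Rightarrow> real \<Rightarrow> real \<Rightarrow>
     'b \<Rightarrow> (real \<Rightarrow> 'a) \<Rightarrow> real \<Rightarrow> bool" where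
  "sdp_choice A \<theta> \<alpha>0 \<tau> \<delta> yd xs \<alpha> \<longleftrightarrow>
     \<alpha> \<in> sdp_grid \<theta> \<alpha>0 \<and>
     norm (A (xs \<alpha>) - yd) \<le> \<tau> * \<delta> \<and> \<tau> * \<delta> < norm (A (xs (\<alpha> / \<theta>)) - yd)"

text \<open>
  All regularized solutions that the sequential discrepancy principle can produce at noise
  level \<open>\<delta>\<close>: any admissible data, any selection of minimizers, any parameter chosen by the principle.
\<close>

definition sdp_solutions ::
    "('a::real_inner \<Rightarrow> 'b::real_normed_vector) \<Rightarrow> (nat \<Rightarrow> 'a) \<Rightarrow> (nat \<Rightarrow> real) \<Rightarrow> real \<Rightarrow> real \<Rightarrow>
     real \<Rightarrow> real \<Rightarrow> real \<Rightarrow> 'b \<Rightarrow> real \<Rightarrow> 'a set" where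
  "sdp_solutions A u w p q \<theta> \<alpha>0 \<tau> y \<delta> =
     {xs \<alpha> | yd xs \<alpha>. norm (y - yd) \<le> \<delta> \<and>
        minimizer_selection A u w p q yd (sdp_grid \<theta> \<alpha>0) xs \<and>
        sdp_choice A \<theta> \<alpha>0 \<tau> \<delta> yd xs \<alpha>}"

text \<open>
  ``Increasing'' is non-strict: \<open>rate_fun\<close> below is constant for large arguments as soon as
  \<open>1\<close> does not belong to the support, since then the sum over \<open>k \<le> 1\<close> is empty.
\<close>

definition index_function :: "(real \<Rightarrow> real) \<Rightarrow> bool" where
  "index_function \<phi> \<longleftrightarrow>
     (\<forall>t>0. \<phi> t > 0) \<and> mono_on {0<..} \<phi> \<and> (\<phi> \<longlongrightarrow> 0) (at_right 0)"

text \<open>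
  The tails are real-valued infinite sums; they are meant for \<open>x\<close> in \<open>M_qw u w q\<close>, where
  they converge.
\<close>

definition rate_fun ::
    "(nat \<Rightarrow> 'a::real_inner) \<Rightarrow> (nat \<Rightarrow> real) \<Rightarrow> (nat \<Rightarrow> 'b::real_normed_vector \<Rightarrow>\<^sub>L real) \<Rightarrow> 'a \<Rightarrow>
     real \<Rightarrow> real \<Rightarrow> real" where
  "rate_fun u w f x q t =
     2 * (INF n\<in>{1::nat..}. (\<Sum>\<^sub>\<infinity>k\<in>{n+1..}. w k * \<bar>x \<bullet> u k\<bar> powr q)
            + t powr q * (\<Sum>k\<in>supp u x \<inter> {1..n}. w k * norm (f k) powr q))"

text \<open>
  For finite support, the factor \<open>2\<close> in \<open>rate_fun\<close> makes \<open>2 powr (1 / q) * C_qw u w f x q\<close> the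
  constant of the linear bound. As \<open>q\<close> tends to \<open>0\<close>, the sum in \<open>C_qw\<close> tends to the sum of the weights
  over the support, so \<open>C_qw\<close> tends to \<open>\<infinity>\<close> if that sum exceeds \<open>1\<close> and to \<open>0\<close> if it is below \<open>1\<close>;
  after division of the weights by a lower bound \<open>w0\<close> two support elements always suffice.
\<close>

definition C_qw ::
    "(nat \<Rightarrow> 'a::real_inner) \<Rightarrow> (nat \<Rightarrow> real) \<Rightarrow> (nat \<Rightarrow> 'b::real_normed_vector \<Rightarrow>\<^sub>L real) \<Rightarrow> 'a \<Rightarrow>
     real \<Rightarrow> real" where
  "C_qw u w f x q = (\<Sum>k\<in>supp u x. w k * norm (f k) powr q) powr (1 / q)"

end

theory Submission
  imports Defs
begin

text \<open>
  Write \<open>R\<close> for the penalty and \<open>\<phi>\<close> for the rate function. The source condition and the subadditivity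
  of \<open>t \<mapsto> t\<^sup>q\<close> give the variational inequality \<open>R (x - xd) \<le> R x - R xd + \<phi> (\<parallel>A x - A xd\<parallel>)\<close>. At the
  chosen parameter \<open>\<alpha>\<close>, comparison of the minimizer with \<open>xd\<close> bounds \<open>R x - R xd\<close> by
  \<open>\<delta>\<^sup>p / (p \<alpha>)\<close>. At \<open>\<alpha> / \<theta>\<close>, where the misfit exceeds \<open>\<tau> \<delta>\<close>, the same comparison together with the
  variational inequality and \<open>\<phi> (c t) \<le> c \<phi> t\<close> for \<open>c \<ge> 1\<close> yields \<open>\<delta>\<^sup>p / \<alpha> = O(\<phi> \<delta>)\<close>.
\<close>

section \<open>Powers with exponent at most 1 and nonnegative infinite sums\<close>

text \<open>After division by \<open>s = a + b\<close> both terms lie in the unit interval, where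
  \<open>c \<le> c powr q\<close>. The two quotients add up to 1.\<close>

lemma powr_add_le_add_powr:
  fixes a b q :: real
  assumes "0 \<le> a" "0 \<le> b" "0 < q" "q \<le> 1"
  shows "(a + b) powr q \<le> a powr q + b powr q"
proof (cases "a + b = 0")
  case True
  then show ?thesis by simp
next
  case False
  define s where "s = a + b"
  have s: "0 < s" using False assms by (simp add: s_def)
  have ge: "c / s \<le> c powr q / s powr q" if "0 \<le> c" "c \<le> s" for c
  proof -
    have "(c / s) powr 1 \<le> (c / s) powr q"
      using that s assms by (intro powr_mono') auto
    then show ?thesis using that s by (simp add: powr_divide)
  qed
  have "1 = a / s + b / s"
    using s by (simp add: s_def flip: add_divide_distrib)
  also have "\<dots> \<le> a powr q / s powr q + b powr q / s powr q"
    using assms by (intro add_mono ge) (auto simp: s_def)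
  finally show ?thesis
    using s by (simp add: field_simps flip: s_def)
qed

lemma concave_on_powr:
  fixes q :: real
  assumes "0 \<le> q" "q \<le> 1"
  shows "concave_on {0<..} (\<lambda>t::real. t powr q)"
proof (rule f''_le0_imp_concave)
  fix t :: real assume "t \<in> {0<..}"
  then show "((\<lambda>t. t powr q) has_real_derivative q * t powr (q - 1)) (at t)"
    and "((\<lambda>t. q * t powr (q - 1)) has_real_derivative q * ((q - 1) * t powr (q - 1 - 1))) (at t)"
    by (auto intro!: derivative_eq_intros)
  show "q * ((q - 1) * t powr (q - 1 - 1)) \<le> 0"
    using assms by (intro mult_nonneg_nonpos mult_nonpos_nonneg) auto
qed simp

text \<open>Both sides are the supremum of the same finite partial sums.\<close>

lemma infsum_ennreal_eq:
  fixes g :: "'i \<Rightarrow> real"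
  assumes "g summable_on I" "\<And>k. k \<in> I \<Longrightarrow> 0 \<le> g k"
  shows "(\<Sum>\<^sub>\<infinity>k\<in>I. ennreal (g k)) = ennreal (infsum g I)"
proof -
  have "sum (\<lambda>k. ennreal (g k)) F = ennreal (sum g F)"
    if "F \<in> {F. finite F \<and> F \<subseteq> I}" for F
    using that assms(2) by (auto intro!: sum_ennreal)
  then show ?thesis
    using infsum_nonneg_is_SUPREMUM_ennreal[OF assms]
    by (subst nonneg_infsum_complete) (auto intro!: SUP_cong)
qed

lemma summable_on_if_infsum_ennreal_finite:
  fixes g :: "'i \<Rightarrow> real"
  assumes "(\<Sum>\<^sub>\<infinity>k\<in>I. ennreal (g k)) < \<infinity>" "\<And>k. k \<in> I \<Longrightarrow> 0 \<le> g k"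
  shows "g summable_on I"
proof (rule nonneg_bdd_above_summable_on)
  define B where "B = (\<Sum>\<^sub>\<infinity>k\<in>I. ennreal (g k))"
  show "bdd_above (sum g ` {F. F \<subseteq> I \<and> finite F})"
  proof (rule bdd_aboveI2)
    fix F assume F: "F \<in> {F. F \<subseteq> I \<and> finite F}"
    have "ennreal (sum g F) = (\<Sum>k\<in>F. ennreal (g k))"
      using F assms(2) by (intro sum_ennreal[symmetric]) auto
    also have "\<dots> \<le> B"
      unfolding B_def using F by (subst nonneg_infsum_complete) (auto intro!: SUP_upper)
    finally show "sum g F \<le> enn2real B"
      using assms(1) unfolding B_def
      by (metis enn2real_nonneg ennreal_enn2real ennreal_le_iff infinity_ennreal_def)
  qed
qed (use assms(2) in auto)

text \<open>Each \<open>a k powr q\<close> is at most the total \<open>S\<close>. Splitting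
  \<open>a k\<close> into \<open>a k powr q * a k powr (1 - q)\<close> and bounding the second
  factor by \<open>S powr (1 / q - 1)\<close> gives a summable majorant with sum
  \<open>S powr (1 / q)\<close>.\<close>

lemma l1_le_lq:
  fixes a :: "'i \<Rightarrow> real" and q :: real
  assumes "(\<lambda>k. a k powr q) summable_on I" "\<And>k. k \<in> I \<Longrightarrow> 0 \<le> a k" "0 < q" "q \<le> 1"
  shows "a summable_on I"
    and "infsum a I \<le> (\<Sum>\<^sub>\<infinity>k\<in>I. a k powr q) powr (1 / q)"
proof -
  define S where "S = (\<Sum>\<^sub>\<infinity>k\<in>I. a k powr q)"
  have S0: "0 \<le> S" unfolding S_def by (intro infsum_nonneg) auto
  have le: "a k \<le> a k powr q * S powr (1 / q - 1)" if k: "k \<in> I" for k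
  proof (cases "a k = 0")
    case False
    then have pos: "0 < a k" using assms(2)[OF k] by simp
    have "(\<Sum>\<^sub>\<infinity>j\<in>{k}. a j powr q) \<le> S"
      unfolding S_def using assms k by (intro infsum_mono2) auto
    then have "a k powr q \<le> S" by simp
    then have "(a k powr q) powr (1 / q - 1) \<le> S powr (1 / q - 1)"
      using assms by (intro powr_mono2) (auto simp: field_simps)
    moreover have "(a k powr q) powr (1 / q - 1) = a k powr (1 - q)"
      using assms(3) by (simp add: powr_powr right_diff_distrib)
    moreover have "a k = a k powr q * a k powr (1 - q)"
      using pos by (simp flip: powr_add)
    ultimately show ?thesis by (metis mult_left_mono powr_ge_zero)
  qed simp
  have sum: "(\<lambda>k. a k powr q * S powr (1 / q - 1)) summable_on I"
    using assms(1) by (rule summable_on_cmult_left)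
  then show sa: "a summable_on I"
    by (rule summable_on_comparison_test) (use le assms in auto)
  have "infsum a I \<le> (\<Sum>\<^sub>\<infinity>k\<in>I. a k powr q * S powr (1 / q - 1))"
    using sa sum le by (rule infsum_mono)
  also have "\<dots> = S * S powr (1 / q - 1)"
    unfolding S_def by (rule infsum_cmult_left) (use assms in auto)
  also have "\<dots> = S powr (1 / q)"
  proof (cases "S = 0")
    case False
    then have "S * S powr (1 / q - 1) = S powr 1 * S powr (1 / q - 1)" using S0 by simp
    also have "\<dots> = S powr (1 / q)" by (simp only: flip: powr_add) simp
    finally show ?thesis .
  qed simp
  finally show "infsum a I \<le> (\<Sum>\<^sub>\<infinity>k\<in>I. a k powr q) powr (1 / q)"
    by (simp only: S_def)
qed

section \<open>The infimum behind the rate function\<close>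

text \<open>Half of the rate function, with the tail sums and the weighted source sums replaced by
  arbitrary sequences. The shape of the rate function can then be studied with little more than
  nonnegativity of \<open>T\<close> and \<open>S\<close>.\<close>

definition inf_rate :: "(nat \<Rightarrow> real) \<Rightarrow> (nat \<Rightarrow> real) \<Rightarrow> real \<Rightarrow> real \<Rightarrow> real" where
  "inf_rate T S q t = (INF n\<in>{1..}. T n + t powr q * S n)"

context
  fixes T S :: "nat \<Rightarrow> real" and q :: real
  assumes TS: "\<And>n. 0 \<le> T n" "\<And>n. 0 \<le> S n" and q: "0 < q" "q \<le> 1"
begin

lemma inf_rate_lower: "n \<ge> 1 \<Longrightarrow> inf_rate T S q t \<le> T n + t powr q * S n"
  unfolding inf_rate_def using TS
  by (intro cINF_lower bdd_belowI2[of _ 0]) (auto intro!: add_nonneg_nonneg)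

lemma inf_rate_greatest:
  "(\<And>n. n \<ge> 1 \<Longrightarrow> m \<le> T n + t powr q * S n) \<Longrightarrow> m \<le> inf_rate T S q t"
  unfolding inf_rate_def by (intro cINF_greatest) auto

lemma inf_rate_nonneg: "0 \<le> inf_rate T S q t"
  using TS by (intro inf_rate_greatest) auto

lemma inf_rate_mono: "0 \<le> s \<Longrightarrow> s \<le> t \<Longrightarrow> inf_rate T S q s \<le> inf_rate T S q t"
  by (rule inf_rate_greatest, rule order_trans[OF inf_rate_lower])
     (use TS q in \<open>auto intro!: mult_right_mono powr_mono2\<close>)

text \<open>Since \<open>c powr q \<le> c\<close> for \<open>c \<ge> 1\<close>, every member of the
  family grows by at most the factor \<open>c\<close>, and so does the infimum. This absorbs
  constant multiples of the noise level into the constant of the rate.\<close>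

lemma inf_rate_scale:
  assumes "1 \<le> c" "0 \<le> t"
  shows "inf_rate T S q (c * t) \<le> c * inf_rate T S q t"
proof -
  have "inf_rate T S q (c * t) / c \<le> T n + t powr q * S n" if "n \<ge> 1" for n
  proof -
    have "(c * t) powr q \<le> c * t powr q"
      using assms q powr_mono[of q 1 c] by (simp add: powr_mult mult_right_mono)
    then have "inf_rate T S q (c * t) \<le> T n + c * t powr q * S n"
      using inf_rate_lower[OF that, of "c * t"] TS(2)[of n]
      by (meson add_left_mono mult_right_mono order_trans)
    also have "\<dots> \<le> c * (T n + t powr q * S n)"
      using mult_right_mono[OF assms(1) TS(1)[of n]] by (simp add: algebra_simps)
    finally show ?thesis using assms by (simp add: field_simps)
  qed
  then have "inf_rate T S q (c * t) / c \<le> inf_rate T S q t" by (rule inf_rate_greatest)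
  then show ?thesis using assms by (simp add: field_simps)
qed

text \<open>An infimum of functions that are concave in \<open>t\<close> is concave.\<close>

lemma inf_rate_concave: "concave_on {0<..} (inf_rate T S q)"
  unfolding concave_on_iff
proof (intro conjI ballI allI impI)
  fix x y a b :: real
  assume xy: "x \<in> {0<..}" "y \<in> {0<..}" and ab: "0 \<le> a" "0 \<le> b" "a + b = 1"
  show "a * inf_rate T S q x + b * inf_rate T S q y \<le> inf_rate T S q (a *\<^sub>R x + b *\<^sub>R y)"
  proof (rule inf_rate_greatest)
    fix n :: nat assume n: "n \<ge> 1"
    have "a * x powr q + b * y powr q \<le> (a *\<^sub>R x + b *\<^sub>R y) powr q"
      using concave_on_powr[of q] q xy ab by (auto simp: concave_on_iff)
    then have "(a * x powr q + b * y powr q) * S n \<le> (a *\<^sub>R x + b *\<^sub>R y) powr q * S n"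
      using TS(2) by (rule mult_right_mono)
    moreover have "a * inf_rate T S q x + b * inf_rate T S q y
        \<le> a * (T n + x powr q * S n) + b * (T n + y powr q * S n)"
      using ab n by (intro add_mono mult_left_mono inf_rate_lower) auto
    moreover have "\<dots> = (a + b) * T n + (a * x powr q + b * y powr q) * S n"
      by (simp add: algebra_simps)
    ultimately show "a * inf_rate T S q x + b * inf_rate T S q y
        \<le> T n + (a *\<^sub>R x + b *\<^sub>R y) powr q * S n"
      using ab by simp
  qed
qed simp

lemma inf_rate_tendsto_0:
  assumes "T \<longlonglongrightarrow> 0"
  shows "(inf_rate T S q \<longlongrightarrow> 0) (at_right 0)"
proof (rule order_tendstoI)
  fix e :: real assume "0 < e"
  \<comment> \<open>The index \<open>n\<close> is fixed first, to make the tail small. Only then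
    does \<open>t\<close> tend to 0, which removes the term with the fixed factor
    \<open>S n\<close>.\<close>
  have "\<forall>\<^sub>F n in sequentially. T n < e"
    using assms \<open>0 < e\<close> by (rule order_tendstoD)
  then have "\<forall>\<^sub>F n in sequentially. T n < e \<and> n \<ge> 1"
    using eventually_ge_at_top by (rule eventually_conj)
  then obtain n where n: "T n < e" "n \<ge> 1"
    by (auto simp: eventually_sequentially)
  have "((\<lambda>t. t powr q) \<longlongrightarrow> 0) (at_right 0)"
    using q by (intro tendsto_zero_powrI[of "\<lambda>t. t" _ "\<lambda>_. q" q])
      (auto intro: tendsto_eq_intros simp: eventually_at_right_less eventually_at_filter)
  then have "((\<lambda>t. T n + t powr q * S n) \<longlongrightarrow> T n + 0 * S n) (at_right 0)"
    by (intro tendsto_intros)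
  then have "\<forall>\<^sub>F t in at_right 0. T n + t powr q * S n < e"
    using n by (intro order_tendstoD) auto
  then show "\<forall>\<^sub>F t in at_right 0. inf_rate T S q t < e"
    by eventually_elim (use inf_rate_lower[OF n(2)] in \<open>rule order_le_less_trans\<close>)
next
  fix e :: real assume "e < 0"
  then show "\<forall>\<^sub>F t in at_right 0. e < inf_rate T S q t"
    using inf_rate_nonneg by (auto intro!: always_eventually intro: less_le_trans)
qed

end

section \<open>Coefficients with respect to the orthonormal basis\<close>

text \<open>No Parseval identity is used. The condition
  \<open>z \<bullet> v \<le> norm v * R\<close> is closed in \<open>v\<close> and holds on the span
  of the basis, hence everywhere; the choice \<open>v = z\<close> gives the claim.\<close>

lemma norm_le_infsum_coefficients:
  assumes u: "orthonormal_basis u" and sum: "(\<lambda>k. \<bar>z \<bullet> u k\<bar>) summable_on {1..}"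
  shows "norm z \<le> (\<Sum>\<^sub>\<infinity>k\<in>{1..}. \<bar>z \<bullet> u k\<bar>)"
proof -
  define R where "R = (\<Sum>\<^sub>\<infinity>k\<in>{1..}. \<bar>z \<bullet> u k\<bar>)"
  have on: "u i \<bullet> u j = (if i = j then 1 else 0)" if "i \<ge> 1" "j \<ge> 1" for i j
    using u that by (auto simp: orthonormal_basis_def)
  have "z \<bullet> v \<le> norm v * R" if v: "v \<in> span (u ` {1..})" for v
  proof -
    obtain t r where t: "finite t" "t \<subseteq> u ` {1..}" "v = (\<Sum>a\<in>t. r a *\<^sub>R a)"
      using v by (auto simp: span_explicit)
    \<comment> \<open>Choosing one index per vector turns the sum over vectors into a sum over
      indices.\<close>
    then obtain F where F: "F \<subseteq> {1..}" "inj_on u F" "t = u ` F"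
      by (auto simp: subset_image_inj)
    have fin: "finite F" using t F by (simp add: finite_image_iff)
    have v_eq: "v = (\<Sum>k\<in>F. r (u k) *\<^sub>R u k)"
      using F t by (simp add: sum.reindex)
    \<comment> \<open>By orthonormality the coefficient is \<open>v \<bullet> u k\<close>, so
      Cauchy-Schwarz with a unit vector applies.\<close>
    have coeff: "\<bar>r (u k)\<bar> \<le> norm v" if k: "k \<in> F" for k
    proof -
      have k1: "k \<ge> 1" using k F by auto
      have "v \<bullet> u k = (\<Sum>j\<in>F. r (u j) * (if j = k then 1 else 0))"
        unfolding v_eq inner_sum_left using F k1 by (intro sum.cong) (auto simp: on subset_iff)
      also have "\<dots> = (\<Sum>j\<in>F. if j = k then r (u j) else 0)"
        by (intro sum.cong) auto
      also have "\<dots> = r (u k)" using k fin by simp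
      finally show ?thesis
        using Cauchy_Schwarz_ineq2[of v "u k"] on[OF k1 k1] by (simp add: norm_eq_sqrt_inner)
    qed
    have "z \<bullet> v = (\<Sum>k\<in>F. r (u k) * (z \<bullet> u k))"
      by (simp add: v_eq inner_sum_right)
    also have "\<dots> \<le> (\<Sum>k\<in>F. norm v * \<bar>z \<bullet> u k\<bar>)"
    proof (rule sum_mono)
      fix k assume "k \<in> F"
      have "r (u k) * (z \<bullet> u k) \<le> \<bar>r (u k)\<bar> * \<bar>z \<bullet> u k\<bar>"
        by (metis abs_ge_self abs_mult)
      also have "\<dots> \<le> norm v * \<bar>z \<bullet> u k\<bar>"
        using coeff[OF \<open>k \<in> F\<close>] by (rule mult_right_mono) simp
      finally show "r (u k) * (z \<bullet> u k) \<le> norm v * \<bar>z \<bullet> u k\<bar>" .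
    qed
    also have "\<dots> = norm v * (\<Sum>k\<in>F. \<bar>z \<bullet> u k\<bar>)"
      by (simp add: sum_distrib_left)
    also have "\<dots> \<le> norm v * R"
      unfolding R_def using F fin sum by (intro mult_left_mono finite_sum_le_infsum) auto
    finally show ?thesis .
  qed
  then have "span (u ` {1..}) \<subseteq> {v. z \<bullet> v \<le> norm v * R}" by blast
  then have "closure (span (u ` {1..})) \<subseteq> {v. z \<bullet> v \<le> norm v * R}"
    by (rule closure_minimal) (intro closed_Collect_le continuous_intros)
  then have "z \<bullet> z \<le> norm z * R"
    using u by (auto simp: orthonormal_basis_def)
  then have "norm z * norm z \<le> norm z * R"
    by (simp add: power2_norm_eq_inner flip: power2_eq_square)
  moreover have "0 \<le> R" unfolding R_def by (intro infsum_nonneg) simp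
  ultimately show ?thesis
    unfolding R_def[symmetric] by (cases "z = 0") simp_all
qed

lemma norm_le_R_one:
  assumes "orthonormal_basis u"
  shows "ennreal (norm z) \<le> R_one u z"
proof (cases "R_one u z = \<infinity>")
  case False
  then have sum: "(\<lambda>k. \<bar>z \<bullet> u k\<bar>) summable_on {1..}"
    by (intro summable_on_if_infsum_ennreal_finite)
       (auto simp: R_one_def less_top[symmetric])
  show ?thesis
    unfolding R_one_def using norm_le_infsum_coefficients[OF assms sum] sum
    by (subst infsum_ennreal_eq) (auto intro!: ennreal_leI)
qed simp

lemma supp_nonempty:
  assumes "orthonormal_basis u" "x \<noteq> 0"
  shows "supp u x \<noteq> {}"
proof
  assume "supp u x = {}"
  then have "R_one u x = (\<Sum>\<^sub>\<infinity>k\<in>{1::nat..}. 0)"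
    unfolding R_one_def by (intro infsum_cong) (auto simp: supp_def)
  then show False using norm_le_R_one[OF assms(1), of x] assms(2) by simp
qed

section \<open>The penalty as a real sum, and two limits\<close>

abbreviation pen :: "(nat \<Rightarrow> 'a::real_inner) \<Rightarrow> (nat \<Rightarrow> real) \<Rightarrow> real \<Rightarrow> 'a \<Rightarrow> nat \<Rightarrow> real" where
  "pen u w q x k \<equiv> w k * \<bar>x \<bullet> u k\<bar> powr q"

text \<open>Passage from the extended penalty to real sums, where differences of penalties can be
  formed.\<close>

lemma
  assumes "\<And>k. k \<ge> 1 \<Longrightarrow> 0 \<le> w k"
  shows R_qw_eq: "pen u w q x summable_on {1..} \<Longrightarrow> R_qw u w q x = ennreal (infsum (pen u w q x) {1..})"
    and R_qw_finite_iff: "R_qw u w q x < \<infinity> \<longleftrightarrow> pen u w q x summable_on {1..}"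
proof -
  show eq: "R_qw u w q x = ennreal (infsum (pen u w q x) {1..})" if "pen u w q x summable_on {1..}"
    unfolding R_qw_def using that assms by (intro infsum_ennreal_eq) auto
  show "R_qw u w q x < \<infinity> \<longleftrightarrow> pen u w q x summable_on {1..}"
  proof
    assume "R_qw u w q x < \<infinity>"
    then show "pen u w q x summable_on {1..}"
      unfolding R_qw_def using assms by (intro summable_on_if_infsum_ennreal_finite) auto
  qed (simp add: eq)
qed

text \<open>If the penalty is infinite, so is the right side by the convention in
  \<open>ennreal_powr\<close>. Otherwise \<open>w0 \<le> w k\<close> bounds the unweighted sum of
  powers by the penalty over \<open>w0\<close>, and \<open>l1_le_lq\<close> applies.\<close>

lemma R_one_le_R_qw:
  assumes w0: "0 < w0" and w: "\<And>k. k \<ge> 1 \<Longrightarrow> w0 \<le> w k" and q: "0 < q" "q \<le> 1"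
  shows "R_one u z \<le> ennreal_powr (R_qw u w q z / ennreal w0) (1 / q)"
proof (cases "R_qw u w q z = \<infinity>")
  case True
  then show ?thesis by (simp add: ennreal_powr_def ennreal_top_divide)
next
  case False
  have w_nonneg: "0 \<le> w k" if "k \<ge> 1" for k using w0 w[OF that] by simp
  have sum: "pen u w q z summable_on {1..}"
    using False R_qw_finite_iff[where w = w and u = u and q = q and x = z] w_nonneg by (simp add: less_top)
  define P where "P = infsum (pen u w q z) {1..}"
  have P0: "0 \<le> P" unfolding P_def using w_nonneg by (intro infsum_nonneg) auto
  have R: "R_qw u w q z / ennreal w0 = ennreal (P / w0)"
    using R_qw_eq[where w = w and u = u and q = q and x = z] w_nonneg sum w0 P0 by (simp add: P_def divide_ennreal)
  have le: "\<bar>z \<bullet> u k\<bar> powr q \<le> pen u w q z k / w0" if "k \<in> {1..}" for k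
    using w[of k] w0 that by (simp add: field_simps mult_right_mono)
  have sum': "(\<lambda>k. pen u w q z k / w0) summable_on {1..}"
    using summable_on_cmult_left[OF sum, of "1 / w0"] by simp
  have sumq: "(\<lambda>k. \<bar>z \<bullet> u k\<bar> powr q) summable_on {1..}"
    using sum' by (rule summable_on_comparison_test) (use le in auto)
  have "(\<Sum>\<^sub>\<infinity>k\<in>{1..}. \<bar>z \<bullet> u k\<bar> powr q) \<le> (\<Sum>\<^sub>\<infinity>k\<in>{1..}. pen u w q z k / w0)"
    using sumq sum' le by (rule infsum_mono)
  also have "\<dots> = P / w0"
    using infsum_cmult_left[of "1 / w0" "pen u w q z" "{1..}"] sum by (simp add: P_def)
  finally have "(\<Sum>\<^sub>\<infinity>k\<in>{1..}. \<bar>z \<bullet> u k\<bar> powr q) powr (1 / q) \<le> (P / w0) powr (1 / q)"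
    by (rule powr_mono2[rotated -1]) (use q in \<open>auto intro!: infsum_nonneg\<close>)
  then have "(\<Sum>\<^sub>\<infinity>k\<in>{1..}. \<bar>z \<bullet> u k\<bar>) \<le> (P / w0) powr (1 / q)"
    using l1_le_lq(2)[OF sumq _ q] by simp
  moreover have "R_one u z = ennreal (\<Sum>\<^sub>\<infinity>k\<in>{1..}. \<bar>z \<bullet> u k\<bar>)"
    unfolding R_one_def using l1_le_lq(1)[OF sumq _ q] by (intro infsum_ennreal_eq) auto
  ultimately show ?thesis
    using P0 w0 by (simp add: R ennreal_powr_def ennreal_leI)
qed

text \<open>The tail is the total minus a partial sum, and the initial segments exhaust the index
  set.\<close>

lemma infsum_tail_tendsto_0:
  fixes g :: "nat \<Rightarrow> real"
  assumes "g summable_on {1..}"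
  shows "(\<lambda>n. infsum g {n+1..}) \<longlonglongrightarrow> 0"
proof -
  have split: "infsum g {n+1..} = infsum g {1..} - sum g {1..n}" for n
  proof -
    have "{1..} = {1..n} \<union> {n+1..}" by auto
    moreover have "g summable_on {n+1..}" using assms by (rule summable_on_subset) auto
    ultimately show ?thesis
      using infsum_Un_disjoint[of g "{1..n}" "{n+1..}"] by auto
  qed
  have "filterlim (\<lambda>n. {1..n::nat}) (finite_subsets_at_top {1..}) sequentially"
    unfolding filterlim_finite_subsets_at_top
  proof (intro allI impI)
    fix X :: "nat set" assume X: "finite X \<and> X \<subseteq> {1..}"
    show "\<forall>\<^sub>F n in sequentially. finite {1..n} \<and> X \<subseteq> {1..n} \<and> {1..n} \<subseteq> {1..}"
      using eventually_ge_at_top[of "Max (insert 0 X)"] by eventually_elim (use X in auto)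
  qed
  then have "(\<lambda>n. sum g {1..n}) \<longlonglongrightarrow> infsum g {1..}"
    using infsum_tendsto[OF assms] by (rule filterlim_compose[rotated])
  then have "(\<lambda>n. infsum g {1..} - sum g {1..n}) \<longlonglongrightarrow> infsum g {1..} - infsum g {1..}"
    by (intro tendsto_intros)
  then show ?thesis by (simp only: split diff_self)
qed

lemma powr_tendsto_at_top:
  fixes g :: "real \<Rightarrow> real"
  assumes g: "(g \<longlongrightarrow> L) (at_right 0)" and L: "1 < L"
  shows "filterlim (\<lambda>r. g r powr (1 / r)) at_top (at_right 0)"
proof -
  \<comment> \<open>The base eventually stays above this midpoint, and \<open>c powr (1 / r)\<close>
    diverges because \<open>c\<close> exceeds 1.\<close>
  define c where "c = (1 + L) / 2"
  have c: "1 < c" "c < L" using L by (simp_all add: c_def)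
  have "filterlim (\<lambda>r. ln c * (1 / r)) at_top (at_right 0)"
    using c filterlim_inverse_at_top_right
    by (intro filterlim_tendsto_pos_mult_at_top[OF tendsto_const]) (auto simp: divide_inverse)
  then have lim: "filterlim (\<lambda>r. exp (ln c * (1 / r))) at_top (at_right 0)"
    by (rule filterlim_compose[OF exp_at_top])
  have "\<forall>\<^sub>F r in at_right 0. c < g r" using g c(2) by (rule order_tendstoD)
  moreover have "\<forall>\<^sub>F r::real in at_right 0. 0 < r" by (rule eventually_at_right_less)
  ultimately have "\<forall>\<^sub>F r in at_right 0. exp (ln c * (1 / r)) \<le> g r powr (1 / r)"
  proof eventually_elim
    case (elim r)
    then have "c powr (1 / r) \<le> g r powr (1 / r)" using c by (intro powr_mono2) auto
    then show ?case using c by (simp add: powr_def mult.commute)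
  qed
  with lim show ?thesis by (rule filterlim_at_top_mono)
qed

section \<open>Source condition and sparse solutions\<close>

text \<open>The exponent stays free here because the claims on sparse solutions range over all
  exponents; \<open>regularization\<close> fixes it.\<close>

locale source_condition =
  fixes A :: "'a::{real_inner, complete_space} \<Rightarrow> 'b::banach"
    and u :: "nat \<Rightarrow> 'a" and w :: "nat \<Rightarrow> real" and f :: "nat \<Rightarrow> 'b \<Rightarrow>\<^sub>L real"
    and xd :: 'a
  assumes A: "bounded_linear A"
    and basis: "orthonormal_basis u"
    and w_pos: "\<And>k. k \<ge> 1 \<Longrightarrow> 0 < w k"
    and source: "\<And>k. k \<in> supp u xd \<Longrightarrow> u k = dual_adjoint A (f k)"
begin

definition tail :: "real \<Rightarrow> nat \<Rightarrow> real" where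
  "tail q n = infsum (pen u w q xd) {n+1..}"

definition head :: "real \<Rightarrow> nat \<Rightarrow> real" where
  "head q n = (\<Sum>k\<in>supp u xd \<inter> {1..n}. w k * norm (f k) powr q)"

lemma supp_ge_1: "k \<in> supp u xd \<Longrightarrow> 1 \<le> k"
  by (simp add: supp_def)

lemma pen_nonneg: "1 \<le> k \<Longrightarrow> 0 \<le> pen u w q z k"
  using w_pos[of k] by simp

lemma tail_nonneg: "0 \<le> tail q n"
  unfolding tail_def by (intro infsum_nonneg pen_nonneg) auto

lemma head_nonneg: "0 \<le> head q n"
  unfolding head_def by (intro sum_nonneg) (auto simp: w_pos less_imp_le)

lemma rate_fun_eq: "rate_fun u w f xd q t = 2 * inf_rate (tail q) (head q) q t"
  by (simp add: rate_fun_def inf_rate_def tail_def head_def)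

text \<open>The functional \<open>f k\<close> takes the value 1 at \<open>A (u k)\<close>.\<close>

lemma f_nonzero:
  assumes "k \<in> supp u xd"
  shows "0 < norm (f k)"
proof -
  have "f k (A (u k)) = u k \<bullet> u k"
    using dual_adjoint_works[OF A, of "f k" "u k"] source[OF assms] by simp
  also have "\<dots> = 1"
    using basis supp_ge_1[OF assms] by (simp add: orthonormal_basis_def)
  finally show ?thesis by auto
qed

text \<open>Here the source condition enters: moving \<open>A\<close> from one side of the pairing
  to the other controls a single coefficient by the size of the image in the data space.\<close>

lemma coefficient_bound:
  assumes "k \<in> supp u xd"
  shows "\<bar>z \<bullet> u k\<bar> \<le> norm (f k) * norm (A z)"
proof -
  have "f k (A z) = z \<bullet> u k"
    using dual_adjoint_works[OF A, of "f k" z] source[OF assms] by (simp add: inner_commute)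
  then show ?thesis
    using norm_blinfun[of "f k" "A z"] by simp
qed

lemma sparse_in_M_qw:
  assumes "finite (supp u xd)"
  shows "xd \<in> M_qw u w r"
proof -
  have "pen u w r xd summable_on supp u xd" using assms by simp
  \<comment> \<open>Off the support the summand vanishes for every \<open>r\<close>, including
    \<open>r = 0\<close>, because \<open>0 powr r = 0\<close> by convention.\<close>
  then have "pen u w r xd summable_on {1..}"
    by (rule summable_on_cong_neutral[THEN iffD1, rotated -1]) (auto simp: supp_def)
  then have "R_qw u w r xd < \<infinity>"
    using R_qw_finite_iff[of w u r xd] w_pos by (auto simp: less_imp_le)
  then show ?thesis using assms by (simp add: M_qw_def)
qed

lemma rate_fun_sparse:
  assumes fin: "finite (supp u xd)" and r: "0 < r" "r \<le> 1" and t: "0 < t"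
  shows "rate_fun u w f xd r t powr (1 / r) \<le> 2 powr (1 / r) * C_qw u w f xd r * t"
proof -
  \<comment> \<open>Beyond this index the tail vanishes and the head is the full sum in
    \<open>C_qw\<close>. Inserting 1 makes \<open>n\<close> admissible in the infimum.\<close>
  define n where "n = Max (insert 1 (supp u xd))"
  have n: "1 \<le> n" "supp u xd \<subseteq> {1..n}"
    using fin supp_ge_1 by (auto simp: n_def)
  have "tail r n = (\<Sum>\<^sub>\<infinity>k\<in>{n+1..}. 0)"
    unfolding tail_def
  proof (rule infsum_cong)
    fix k assume k: "k \<in> {n+1..}"
    then have "k \<notin> supp u xd" using n by fastforce
    then show "pen u w r xd k = 0" using k by (simp add: supp_def)
  qed
  then have "tail r n = 0" by simp
  moreover have "head r n = (\<Sum>k\<in>supp u xd. w k * norm (f k) powr r)"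
    using n by (simp add: head_def Int_absorb2)
  ultimately have "rate_fun u w f xd r t \<le> 2 * (t powr r * (\<Sum>k\<in>supp u xd. w k * norm (f k) powr r))"
    using inf_rate_lower[of "tail r" "head r" r n t] tail_nonneg head_nonneg r n
    by (simp add: rate_fun_eq)
  then have "rate_fun u w f xd r t powr (1 / r)
      \<le> (2 * (t powr r * (\<Sum>k\<in>supp u xd. w k * norm (f k) powr r))) powr (1 / r)"
    using r inf_rate_nonneg[of "tail r" "head r" r t] tail_nonneg head_nonneg
    by (intro powr_mono2) (auto simp: rate_fun_eq)
  also have "\<dots> = 2 powr (1 / r) * C_qw u w f xd r * t"
    using r t by (simp add: C_qw_def powr_mult powr_powr)
  finally show ?thesis .
qed

lemma weight_sum_tendsto:
  "((\<lambda>r. \<Sum>k\<in>supp u xd. w k * norm (f k) powr r) \<longlongrightarrow> (\<Sum>k\<in>supp u xd. w k)) (at_right 0)"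
proof (rule tendsto_sum)
  fix k assume k: "k \<in> supp u xd"
  have "((\<lambda>r. w k * norm (f k) powr r) \<longlongrightarrow> w k * norm (f k) powr 0) (at_right 0)"
    using f_nonzero[OF k] by (intro tendsto_intros) auto
  then show "((\<lambda>r. w k * norm (f k) powr r) \<longlongrightarrow> w k) (at_right 0)"
    using f_nonzero[OF k] by simp
qed

text \<open>The prefactor moves inside the power, so the base tends to \<open>c\<close> times the
  sum of the weights. It is used with \<open>c = 1\<close> and with
  \<open>c = 1 / w0\<close>.\<close>

lemma C_qw_at_top:
  assumes c: "0 < c" and gt: "1 < c * (\<Sum>k\<in>supp u xd. w k)"
  shows "filterlim (\<lambda>r. c powr (1 / r) * C_qw u w f xd r) at_top (at_right 0)"
proof -
  have "filterlim (\<lambda>r. (c * (\<Sum>k\<in>supp u xd. w k * norm (f k) powr r)) powr (1 / r))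
      at_top (at_right 0)"
    by (rule powr_tendsto_at_top[OF tendsto_mult_left[OF weight_sum_tendsto] gt])
  then show ?thesis
    using c by (simp add: C_qw_def powr_mult)
qed

end

section \<open>Rate function and variational inequality for a fixed exponent\<close>

locale regularization = source_condition A u w f xd
  for A :: "'a::{real_inner, complete_space} \<Rightarrow> 'b::banach" and u w f xd +
  fixes q :: real
  assumes q: "0 < q" "q \<le> 1"
    and xd_nonzero: "xd \<noteq> 0"
    and xd_sum: "pen u w q xd summable_on {1..}"
begin

abbreviation rate :: "real \<Rightarrow> real" where
  "rate \<equiv> rate_fun u w f xd q"

lemma rate_nonneg: "0 \<le> rate t"
  using inf_rate_nonneg tail_nonneg head_nonneg q by (simp add: rate_fun_eq)

lemma rate_mono: "0 \<le> s \<Longrightarrow> s \<le> t \<Longrightarrow> rate s \<le> rate t"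
  using inf_rate_mono tail_nonneg head_nonneg q by (simp add: rate_fun_eq)

lemma rate_scale: "1 \<le> c \<Longrightarrow> 0 \<le> t \<Longrightarrow> rate (c * t) \<le> c * rate t"
  using inf_rate_scale[OF tail_nonneg head_nonneg q] by (simp add: rate_fun_eq)

lemma concave_on_rate: "concave_on {0<..} rate"
  unfolding rate_fun_eq[abs_def]
  using inf_rate_concave[OF tail_nonneg head_nonneg q] by (intro concave_on_cmul) auto

lemma rate_pos:
  assumes t: "0 < t"
  shows "0 < rate t"
proof -
  obtain k where k: "k \<in> supp u xd"
    using supp_nonempty[OF basis xd_nonzero] by blast
  \<comment> \<open>For each \<open>n\<close> the fixed support index \<open>k\<close> contributes
    either to the head or to the tail. The smaller contribution is a positive lower bound that does
    not depend on \<open>n\<close>.\<close>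
  define m where "m = min (pen u w q xd k) (t powr q * (w k * norm (f k) powr q))"
  have "0 < m"
    using k w_pos[OF supp_ge_1[OF k]] f_nonzero[OF k] t by (auto simp: m_def supp_def)
  moreover have "m \<le> inf_rate (tail q) (head q) q t"
  proof (rule inf_rate_greatest[OF tail_nonneg head_nonneg q])
    fix n :: nat
    show "m \<le> tail q n + t powr q * head q n"
    proof (cases "k \<le> n")
      case True
      have "(\<Sum>j\<in>{k}. w j * norm (f j) powr q) \<le> head q n"
        unfolding head_def using True k supp_ge_1 w_pos
        by (intro sum_mono2) (auto simp: less_imp_le)
      then have "t powr q * (w k * norm (f k) powr q) \<le> t powr q * head q n"
        by (intro mult_left_mono) auto
      then show ?thesis using tail_nonneg[of q n] by (simp add: m_def)
    next
      case False
      have "infsum (pen u w q xd) {k} \<le> tail q n"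
        unfolding tail_def using False supp_ge_1[OF k]
        by (intro infsum_mono2 summable_on_subset[OF xd_sum] pen_nonneg) auto
      moreover have "0 \<le> t powr q * head q n"
        using head_nonneg by simp
      ultimately show ?thesis by (simp add: m_def)
    qed
  qed
  ultimately show ?thesis by (simp add: rate_fun_eq)
qed

lemma index_function_rate: "index_function rate"
proof -
  have "tail q \<longlonglongrightarrow> 0"
    using infsum_tail_tendsto_0[OF xd_sum] unfolding tail_def[abs_def] .
  then have "(rate \<longlongrightarrow> 2 * 0) (at_right 0)"
    unfolding rate_fun_eq[abs_def]
    by (intro tendsto_mult_left inf_rate_tendsto_0 tail_nonneg head_nonneg q)
  then show ?thesis
    using rate_pos rate_mono by (auto simp: index_function_def intro!: mono_onI)
qed

text \<open>
  On the support up to \<open>n\<close> one uses \<open>\<bar>xd\<bar>\<^sup>q \<le> \<bar>x\<bar>\<^sup>q + \<bar>x - xd\<bar>\<^sup>q\<close> and the source condition,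
  beyond \<open>n\<close> one uses \<open>\<bar>x - xd\<bar>\<^sup>q \<le> \<bar>x\<bar>\<^sup>q + \<bar>xd\<bar>\<^sup>q\<close>; the infimum over \<open>n\<close> gives the rate function.
\<close>

lemma variational_inequality:
  assumes x_sum: "pen u w q x summable_on {1..}"
  shows "pen u w q (x - xd) summable_on {1..}"
    and "infsum (pen u w q (x - xd)) {1..} + infsum (pen u w q xd) {1..}
      \<le> infsum (pen u w q x) {1..} + rate (norm (A x - A xd))"
proof -
  define t where "t = norm (A x - A xd)"
  have diff: "pen u w q (x - xd) k \<le> pen u w q x k + pen u w q xd k" if k: "k \<in> {1..}" for k
  proof -
    have "\<bar>(x - xd) \<bullet> u k\<bar> powr q \<le> (\<bar>x \<bullet> u k\<bar> + \<bar>xd \<bullet> u k\<bar>) powr q"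
      using q by (intro powr_mono2) (auto simp: inner_diff_left)
    also have "\<dots> \<le> \<bar>x \<bullet> u k\<bar> powr q + \<bar>xd \<bullet> u k\<bar> powr q"
      using q by (intro powr_add_le_add_powr) auto
    finally show ?thesis
      using w_pos[of k] k by (simp flip: distrib_left)
  qed
  have diff': "pen u w q xd k \<le> pen u w q x k + pen u w q (x - xd) k" if k: "k \<in> {1..}" for k
  proof -
    have "\<bar>xd \<bullet> u k\<bar> powr q \<le> (\<bar>x \<bullet> u k\<bar> + \<bar>(x - xd) \<bullet> u k\<bar>) powr q"
      using q by (intro powr_mono2) (auto simp: inner_diff_left)
    also have "\<dots> \<le> \<bar>x \<bullet> u k\<bar> powr q + \<bar>(x - xd) \<bullet> u k\<bar> powr q"
      using q by (intro powr_add_le_add_powr) auto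
    finally show ?thesis
      using w_pos[of k] k by (simp flip: distrib_left)
  qed
  have src: "pen u w q (x - xd) k \<le> t powr q * (w k * norm (f k) powr q)"
    if k: "k \<in> supp u xd" for k
  proof -
    have "\<bar>(x - xd) \<bullet> u k\<bar> powr q \<le> (norm (f k) * t) powr q"
      using coefficient_bound[OF k, of "x - xd"] q A
      by (intro powr_mono2) (auto simp: t_def bounded_linear.linear linear_diff)
    then have "\<bar>(x - xd) \<bullet> u k\<bar> powr q \<le> t powr q * norm (f k) powr q"
      by (simp add: powr_mult t_def mult.commute)
    then have "w k * \<bar>(x - xd) \<bullet> u k\<bar> powr q \<le> w k * (t powr q * norm (f k) powr q)"
      using w_pos[OF supp_ge_1[OF k]] by simp
    then show ?thesis by (simp add: mult_ac)
  qed
  show sum: "pen u w q (x - xd) summable_on {1..}"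
    using summable_on_add[OF x_sum xd_sum]
    by (rule summable_on_comparison_test) (use diff pen_nonneg in auto)
  define D where "D = infsum (pen u w q (x - xd)) {1..} + infsum (pen u w q xd) {1..}
      - infsum (pen u w q x) {1..}"
  have "D / 2 \<le> inf_rate (tail q) (head q) q t"
  proof (rule inf_rate_greatest[OF tail_nonneg head_nonneg q])
    fix n :: nat
    \<comment> \<open>A termwise error bound whose sum is exactly the \<open>n\<close>-th member of
      the infimum.\<close>
    define h where "h k = (if k \<le> n then if k \<in> supp u xd then t powr q * (w k * norm (f k) powr q)
      else 0 else pen u w q xd k)" for k
    have "(h has_sum (\<Sum>k\<in>{1..n}. h k)) {1..n}"
      by (rule has_sum_finite) simp
    also have "(\<Sum>k\<in>{1..n}. h k) = (\<Sum>k\<in>supp u xd \<inter> {1..n}. t powr q * (w k * norm (f k) powr q))"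
      by (intro sum.mono_neutral_cong_right) (auto simp: h_def)
    also have "\<dots> = t powr q * head q n"
      by (simp add: head_def sum_distrib_left)
    finally have h1: "(h has_sum (t powr q * head q n)) {1..n}" .
    have "pen u w q xd summable_on {n+1..}"
      using xd_sum by (rule summable_on_subset) auto
    then have "(pen u w q xd has_sum tail q n) {n+1..}"
      unfolding tail_def by (rule has_sum_infsum)
    then have h2: "(h has_sum tail q n) {n+1..}"
      by (rule has_sum_cong[THEN iffD1, rotated]) (auto simp: h_def)
    have "(h has_sum (t powr q * head q n + tail q n)) ({1..n} \<union> {n+1..})"
      using h1 h2 by (rule has_sum_Un_disjoint) auto
    moreover have "{1..n} \<union> {n+1..} = {1..}" by auto
    ultimately have h: "(h has_sum (t powr q * head q n + tail q n)) {1..}" by simp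
    \<comment> \<open>The factor 2 of \<open>rate_fun\<close> arises here: on the support up to
      \<open>n\<close> the term of \<open>x - xd\<close> is counted twice, beyond \<open>n\<close>
      that of \<open>xd\<close>. Off the support up to \<open>n\<close> the terms of
      \<open>x - xd\<close> and \<open>x\<close> coincide, so no error occurs.\<close>
    have le: "pen u w q (x - xd) k + pen u w q xd k \<le> pen u w q x k + 2 * h k" if "k \<in> {1..}" for k
    proof (cases "k \<le> n")
      case True
      show ?thesis
      proof (cases "k \<in> supp u xd")
        case True
        then show ?thesis using diff'[OF that] src[OF True] \<open>k \<le> n\<close> by (simp add: h_def)
      next
        case False
        then have "xd \<bullet> u k = 0" using that by (simp add: supp_def)
        then show ?thesis using \<open>k \<le> n\<close> False by (simp add: h_def inner_diff_left)
      qed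
    qed (use diff[OF that] in \<open>simp add: h_def\<close>)
    have "infsum (pen u w q (x - xd)) {1..} + infsum (pen u w q xd) {1..}
        \<le> infsum (pen u w q x) {1..} + 2 * (t powr q * head q n + tail q n)"
      using has_sum_add[OF has_sum_infsum[OF sum] has_sum_infsum[OF xd_sum]]
        has_sum_add[OF has_sum_infsum[OF x_sum] has_sum_cmult_right[OF h, of 2]] le
      by (rule has_sum_mono)
    then show "D / 2 \<le> tail q n + t powr q * head q n"
      by (simp add: D_def)
  qed
  then show "infsum (pen u w q (x - xd)) {1..} + infsum (pen u w q xd) {1..}
      \<le> infsum (pen u w q x) {1..} + rate (norm (A x - A xd))"
    by (simp add: D_def rate_fun_eq t_def)
qed

section \<open>Tikhonov minimizers and the discrepancy principle\<close>

text \<open>The functional is finite at \<open>xd\<close>, hence at the minimizer, and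
  \<open>\<alpha> > 0\<close> then makes the penalty of \<open>x\<close> finite. The comparison of
  the two values thereby becomes an inequality between reals.\<close>

lemma minimizer_bound:
  assumes min: "is_arg_min (tikhonov A u w p q yd \<alpha>) (\<lambda>_. True) x" and p: "0 < p" and \<alpha>: "0 < \<alpha>"
  shows "pen u w q x summable_on {1..}"
    and "1 / p * norm (A x - yd) powr p + \<alpha> * infsum (pen u w q x) {1..}
      \<le> 1 / p * norm (A xd - yd) powr p + \<alpha> * infsum (pen u w q xd) {1..}"
proof -
  have w_nonneg: "0 \<le> w k" if "k \<ge> 1" for k using w_pos[OF that] by simp
  have tikhonov_eq: "tikhonov A u w p q yd \<alpha> z
      = ennreal (1 / p * norm (A z - yd) powr p + \<alpha> * infsum (pen u w q z) {1..})"
    if "pen u w q z summable_on {1..}" for z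
  proof -
    have "0 \<le> infsum (pen u w q z) {1..}" by (intro infsum_nonneg pen_nonneg) auto
    then show ?thesis
      using R_qw_eq[OF w_nonneg that] p \<alpha> by (simp add: tikhonov_def ennreal_mult)
  qed
  have le: "tikhonov A u w p q yd \<alpha> x \<le> tikhonov A u w p q yd \<alpha> xd"
    using min by (simp add: is_arg_min_def not_less)
  also have "\<dots> < \<infinity>"
    by (simp add: tikhonov_eq[OF xd_sum])
  finally have "R_qw u w q x < \<infinity>"
    using \<alpha> by (cases "R_qw u w q x = \<infinity>") (auto simp: tikhonov_def ennreal_mult_top less_top)
  then show sum: "pen u w q x summable_on {1..}"
    using R_qw_finite_iff[of w u q x] w_nonneg by simp
  have "0 \<le> 1 / p * norm (A xd - yd) powr p + \<alpha> * infsum (pen u w q xd) {1..}"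
    using p \<alpha> by (intro add_nonneg_nonneg mult_nonneg_nonneg infsum_nonneg pen_nonneg) auto
  then show "1 / p * norm (A x - yd) powr p + \<alpha> * infsum (pen u w q x) {1..}
      \<le> 1 / p * norm (A xd - yd) powr p + \<alpha> * infsum (pen u w q xd) {1..}"
    using le by (simp only: tikhonov_eq[OF sum] tikhonov_eq[OF xd_sum] ennreal_le_iff)
qed

text \<open>
  The lower discrepancy bound at \<open>\<beta>\<close> forces the misfit to exceed the noise level by a fixed factor,
  so \<open>\<beta>\<close> cannot be too small.
\<close>

lemma parameter_lower_bound:
  assumes min: "is_arg_min (tikhonov A u w p q yd \<beta>) (\<lambda>_. True) x"
    and p: "1 < p" and \<beta>: "0 < \<beta>" and \<tau>: "1 < \<tau>" and \<delta>: "0 < \<delta>"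
    and noise: "norm (A xd - yd) \<le> \<delta>" and gt: "\<tau> * \<delta> < norm (A x - yd)"
  shows "\<delta> powr p * (1 - (1 / \<tau>) powr p) \<le> 2 * p * \<beta> * rate \<delta>"
proof -
  define s where "s = norm (A x - yd)"
  define \<kappa> where "\<kappa> = 1 - (1 / \<tau>) powr p"
  have \<kappa>: "0 \<le> \<kappa>"
    using powr_mono2[of p "1 / \<tau>" 1] \<tau> p by (simp add: \<kappa>_def)
  have "\<delta> < \<tau> * \<delta>" using \<tau> \<delta> by simp
  then have s: "\<delta> < s" "0 < s" using gt \<delta> unfolding s_def by linarith+
  have "norm (A x - A xd) \<le> s + \<delta>"
    using norm_triangle_ineq4[of "A x - yd" "A xd - yd"] noise by (simp add: s_def)
  \<comment> \<open>As \<open>\<delta> < s\<close>, the residual is at most \<open>2 * s\<close>.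
    Written as a multiple of \<open>\<delta>\<close> with factor at least 1, it allows
    \<open>rate_scale\<close> to return to \<open>rate \<delta>\<close> at a cost linear in
    \<open>s\<close>.\<close>
  then have "rate (norm (A x - A xd)) \<le> rate (2 * s / \<delta> * \<delta>)"
    using s \<delta> by (intro rate_mono) auto
  also have "\<dots> \<le> 2 * s / \<delta> * rate \<delta>"
    using s \<delta> by (intro rate_scale) (auto simp: field_simps)
  finally have rate_le: "rate (norm (A x - A xd)) \<le> 2 * s / \<delta> * rate \<delta>" .
  \<comment> \<open>The misfit of \<open>xd\<close> is smaller than \<open>s\<close> by the factor
    \<open>\<tau>\<close>, so after subtraction a fixed share \<open>\<kappa>\<close> of
    \<open>s powr p\<close> survives.\<close>
  have "\<delta> \<le> s / \<tau>" using gt \<tau> by (simp add: s_def field_simps)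
  then have "norm (A xd - yd) powr p \<le> (s * (1 / \<tau>)) powr p"
    using noise p by (intro powr_mono2) auto
  also have "\<dots> = s powr p * (1 - \<kappa>)"
    by (simp only: powr_mult \<kappa>_def) simp
  finally have data: "norm (A xd - yd) powr p \<le> s powr p * (1 - \<kappa>)" .
  have "0 \<le> infsum (pen u w q (x - xd)) {1..}"
    by (intro infsum_nonneg pen_nonneg) auto
  then have "infsum (pen u w q xd) {1..} - infsum (pen u w q x) {1..} \<le> 2 * s / \<delta> * rate \<delta>"
    using variational_inequality(2)[OF minimizer_bound(1)[OF min]] rate_le p \<beta> by simp
  then have "\<beta> * (infsum (pen u w q xd) {1..} - infsum (pen u w q x) {1..})
      \<le> \<beta> * (2 * s / \<delta> * rate \<delta>)"
    using \<beta> by (intro mult_left_mono) auto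
  moreover have "1 / p * s powr p - 1 / p * norm (A xd - yd) powr p
      \<le> \<beta> * (infsum (pen u w q xd) {1..} - infsum (pen u w q x) {1..})"
    using minimizer_bound(2)[OF min] p \<beta> by (simp add: s_def algebra_simps)
  moreover have "1 / p * (s powr p * \<kappa>) \<le> 1 / p * s powr p - 1 / p * norm (A xd - yd) powr p"
    using mult_left_mono[OF data, of "1 / p"] p by (simp add: algebra_simps)
  ultimately have "1 / p * (s powr p * \<kappa>) \<le> \<beta> * (2 * s / \<delta> * rate \<delta>)"
    by linarith
  then have "s powr p * \<kappa> \<le> s * (2 * p * \<beta> * rate \<delta> / \<delta>)"
    using p by (simp add: field_simps)
  \<comment> \<open>One factor \<open>s\<close> cancels against the linear cost from scaling. Since
    \<open>p > 1\<close>, the remaining power is monotone and \<open>s\<close> can be replaced by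
    \<open>\<delta>\<close>.\<close>
  moreover have "s powr p = s * s powr (p - 1)"
    using s(2) powr_add[of s 1 "p - 1"] by simp
  ultimately have "s * (s powr (p - 1) * \<kappa>) \<le> s * (2 * p * \<beta> * rate \<delta> / \<delta>)"
    by (simp only: mult.assoc)
  then have "s powr (p - 1) * \<kappa> \<le> 2 * p * \<beta> * rate \<delta> / \<delta>"
    using s(2) by (simp only: mult_le_cancel_left_pos)
  moreover have "\<delta> powr (p - 1) * \<kappa> \<le> s powr (p - 1) * \<kappa>"
    using s \<delta> p \<kappa> by (intro mult_right_mono powr_mono2) auto
  ultimately have "\<delta> powr (p - 1) * \<kappa> \<le> 2 * p * \<beta> * rate \<delta> / \<delta>"
    by linarith
  then have "\<delta> * \<delta> powr (p - 1) * \<kappa> \<le> 2 * p * \<beta> * rate \<delta>"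
    using \<delta> by (simp add: field_simps)
  moreover have "\<delta> powr p = \<delta> * \<delta> powr (p - 1)"
    using \<delta> powr_add[of \<delta> 1 "p - 1"] by simp
  ultimately show ?thesis by (simp add: \<kappa>_def)
qed

text \<open>The first summand of the constant comes from the lower parameter bound at
  \<open>\<alpha> / \<theta>\<close>. The second comes from the misfit bound at
  \<open>\<alpha>\<close>, which keeps the residual within
  \<open>(\<tau> + 1) * \<delta>\<close>.\<close>

lemma sdp_rate:
  assumes p: "1 < p" and \<theta>: "0 < \<theta>" and \<alpha>0: "0 < \<alpha>0" and \<tau>: "1 < \<tau>" and \<delta>: "0 < \<delta>"
    and x: "x \<in> sdp_solutions A u w p q \<theta> \<alpha>0 \<tau> (A xd) \<delta>"
  shows "R_qw u w q (x - xd)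
    \<le> ennreal ((2 / (\<theta> * (1 - (1 / \<tau>) powr p)) + (\<tau> + 1)) * rate \<delta>)"
proof -
  obtain yd xs \<alpha> where x_eq: "x = xs \<alpha>" and noise: "norm (A xd - yd) \<le> \<delta>"
    and sel: "minimizer_selection A u w p q yd (sdp_grid \<theta> \<alpha>0) xs"
    and choice: "sdp_choice A \<theta> \<alpha>0 \<tau> \<delta> yd xs \<alpha>"
    using x by (auto simp: sdp_solutions_def)
  obtain j where j: "\<alpha> = \<theta> powi j * \<alpha>0"
    using choice by (auto simp: sdp_choice_def sdp_grid_def)
  have \<alpha>: "0 < \<alpha>" "0 < \<alpha> / \<theta>" using \<theta> \<alpha>0 by (simp_all add: j)
  \<comment> \<open>The neighbouring parameter lies on the grid too, so the selection provides a
    true minimizer there.\<close>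
  have "\<alpha> / \<theta> = \<theta> powi (j - 1) * \<alpha>0"
    using \<theta> by (simp add: j power_int_diff)
  then have "\<alpha> / \<theta> \<in> sdp_grid \<theta> \<alpha>0" "\<alpha> \<in> sdp_grid \<theta> \<alpha>0"
    using j by (auto simp: sdp_grid_def)
  then have min: "is_arg_min (tikhonov A u w p q yd \<alpha>) (\<lambda>_. True) x"
    and min': "is_arg_min (tikhonov A u w p q yd (\<alpha> / \<theta>)) (\<lambda>_. True) (xs (\<alpha> / \<theta>))"
    using sel by (auto simp: minimizer_selection_def x_eq)
  have misfit: "norm (A x - yd) \<le> \<tau> * \<delta>"
    and misfit': "\<tau> * \<delta> < norm (A (xs (\<alpha> / \<theta>)) - yd)"
    using choice by (auto simp: sdp_choice_def x_eq)
  define \<kappa> where "\<kappa> = 1 - (1 / \<tau>) powr p"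
  have \<kappa>: "0 < \<kappa>"
    using powr_less_mono2[of p "1 / \<tau>" 1] \<tau> p by (simp add: \<kappa>_def)
  have "\<delta> powr p * \<kappa> \<le> 2 * p * (\<alpha> / \<theta>) * rate \<delta>"
    unfolding \<kappa>_def by (rule parameter_lower_bound[OF min' p \<alpha>(2) \<tau> \<delta> noise misfit'])
  then have param: "\<delta> powr p / (p * \<alpha>) \<le> 2 / (\<theta> * \<kappa>) * rate \<delta>"
    using \<alpha>(1) \<theta> \<kappa> p by (simp add: field_simps)
  have x_sum: "pen u w q x summable_on {1..}"
    using minimizer_bound(1)[OF min _ \<alpha>(1)] p by simp
  have "\<alpha> * (infsum (pen u w q x) {1..} - infsum (pen u w q xd) {1..})
      \<le> 1 / p * norm (A xd - yd) powr p - 1 / p * norm (A x - yd) powr p"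
    using minimizer_bound(2)[OF min _ \<alpha>(1)] p by (simp add: right_diff_distrib)
  also have "\<dots> \<le> 1 / p * norm (A xd - yd) powr p" using p by simp
  also have "\<dots> \<le> 1 / p * \<delta> powr p"
    using noise p by (intro mult_left_mono powr_mono2) auto
  finally have pen: "infsum (pen u w q x) {1..} - infsum (pen u w q xd) {1..} \<le> \<delta> powr p / (p * \<alpha>)"
    using \<alpha>(1) p by (simp add: field_simps)
  have "norm (A x - A xd) \<le> (\<tau> + 1) * \<delta>"
    using norm_triangle_ineq4[of "A x - yd" "A xd - yd"] noise misfit by (simp add: distrib_right)
  then have "rate (norm (A x - A xd)) \<le> rate ((\<tau> + 1) * \<delta>)"
    by (intro rate_mono) auto
  also have "\<dots> \<le> (\<tau> + 1) * rate \<delta>"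
    using \<tau> \<delta> by (intro rate_scale) auto
  finally have "infsum (pen u w q (x - xd)) {1..} \<le> (2 / (\<theta> * \<kappa>) + (\<tau> + 1)) * rate \<delta>"
    using variational_inequality(2)[OF x_sum] pen param unfolding distrib_right by linarith
  moreover have "R_qw u w q (x - xd) = ennreal (infsum (pen u w q (x - xd)) {1..})"
    using variational_inequality(1)[OF x_sum] w_pos by (intro R_qw_eq) (auto simp: less_imp_le)
  ultimately show ?thesis by (simp add: \<kappa>_def ennreal_leI)
qed

end

lemma ennreal_powr_le:
  assumes a: "a \<le> ennreal b" and b: "0 \<le> b" and r: "0 \<le> r"
  shows "ennreal_powr a r \<le> ennreal (b powr r)"
proof -
  have fin: "a < \<infinity>" using a by (rule order_le_less_trans) simp
  have "enn2real a \<le> b"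
    using enn2real_mono[OF a] b by simp
  then show ?thesis
    using fin r by (auto simp: ennreal_powr_def intro!: ennreal_leI powr_mono2)
qed

text \<open>The asymptotic bounds are uniform over admissible data, selections and parameters chosen
  by the principle; they are vacuous where no parameter qualifies. Divergence of the constants is
  given once for the original weights, with sum above 1, and once after normalization by
  \<open>w0\<close>.\<close>

theorem corollary4:
  fixes A :: "'a::{real_inner, complete_space} \<Rightarrow> 'b::banach"
    and u :: "nat \<Rightarrow> 'a" and w :: "nat \<Rightarrow> real" and f :: "nat \<Rightarrow> 'b \<Rightarrow>\<^sub>L real"
    and xd :: 'a and y :: 'b
    and w0 p q \<theta> \<alpha>0 \<tau> :: real
  assumes "bounded_linear A" and "inj A" and "\<not> closed (range A)"
    and "orthonormal_basis u"
    and "0 < w0" and "\<And>k. k \<ge> 1 \<Longrightarrow> w0 \<le> w k"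
    and "1 < p" and "0 < q" and "q \<le> 1"
    and "0 < \<theta>" and "\<theta> < 1" and "0 < \<alpha>0" and "1 < \<tau>"
    and "A xd = y" and "xd \<noteq> 0" and "xd \<in> M_qw u w q"
    and "\<And>k. k \<in> supp u xd \<Longrightarrow> u k = dual_adjoint A (f k)"
  shows
    "concave_on {0<..} (rate_fun u w f xd q) \<and> index_function (rate_fun u w f xd q) \<and>
     (\<exists>C. \<forall>\<^sub>F \<delta> in at_right 0. \<forall>x\<in>sdp_solutions A u w p q \<theta> \<alpha>0 \<tau> y \<delta>.
        R_qw u w q (x - xd) \<le> ennreal (C * rate_fun u w f xd q \<delta>)) \<and>
     (\<forall>\<delta>>0. \<forall>x\<in>sdp_solutions A u w p q \<theta> \<alpha>0 \<tau> y \<delta>.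
        ennreal (norm (x - xd)) \<le> R_one u (x - xd) \<and>
        R_one u (x - xd) \<le> ennreal_powr (R_qw u w q (x - xd) / ennreal w0) (1 / q)) \<and>
     (\<exists>C. \<forall>\<^sub>F \<delta> in at_right 0. \<forall>x\<in>sdp_solutions A u w p q \<theta> \<alpha>0 \<tau> y \<delta>.
        ennreal_powr (R_qw u w q (x - xd) / ennreal w0) (1 / q)
          \<le> ennreal (C * rate_fun u w f xd q \<delta> powr (1 / q))) \<and>
     (finite (supp u xd) \<longrightarrow>
        (\<forall>r\<in>{0..1}. xd \<in> M_qw u w r) \<and>
        (\<forall>r\<in>{0<..1}. \<forall>\<delta>>0.
           rate_fun u w f xd r \<delta> powr (1 / r) \<le> 2 powr (1 / r) * C_qw u w f xd r * \<delta>) \<and>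
        (1 < card (supp u xd) \<and> 1 < (\<Sum>k\<in>supp u xd. w k) \<longrightarrow>
           filterlim (C_qw u w f xd) at_top (at_right 0)) \<and>
        (1 < card (supp u xd) \<longrightarrow>
           filterlim (\<lambda>r. (1 / w0) powr (1 / r) * C_qw u w f xd r) at_top (at_right 0)))"
proof -
  have w_pos: "0 < w k" if "k \<ge> 1" for k
    using assms(5) assms(6)[OF that] by simp
  interpret source_condition A u w f xd
    by (rule source_condition.intro) (use assms w_pos in auto)
  have "R_qw u w q xd < \<infinity>"
    using assms(8,16) by (simp add: M_qw_def)
  then have "pen u w q xd summable_on {1..}"
    using R_qw_finite_iff[of w u q xd] w_pos by (auto simp: less_imp_le)
  then interpret regularization A u w f xd q
    by unfold_locales (use assms in auto)
  define C where "C = 2 / (\<theta> * (1 - (1 / \<tau>) powr p)) + (\<tau> + 1)"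
  have "(1 / \<tau>) powr p < 1"
    using powr_less_mono2[of p "1 / \<tau>" 1] assms(7,13) by simp
  then have C: "0 \<le> C"
    using assms(10,13) by (simp add: C_def)
  have bound: "R_qw u w q (x - xd) \<le> ennreal (C * rate_fun u w f xd q \<delta>)"
    if "0 < \<delta>" "x \<in> sdp_solutions A u w p q \<theta> \<alpha>0 \<tau> y \<delta>" for \<delta> x
    unfolding C_def using that assms(7,10,12,13,14) by (intro sdp_rate) auto
  have bound': "ennreal_powr (R_qw u w q (x - xd) / ennreal w0) (1 / q)
      \<le> ennreal ((C / w0) powr (1 / q) * rate_fun u w f xd q \<delta> powr (1 / q))"
    if "0 < \<delta>" "x \<in> sdp_solutions A u w p q \<theta> \<alpha>0 \<tau> y \<delta>" for \<delta> x
  proof -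
    have nonneg: "0 \<le> C * rate_fun u w f xd q \<delta>" using C rate_nonneg by simp
    have "R_qw u w q (x - xd) / ennreal w0 \<le> ennreal (C * rate_fun u w f xd q \<delta>) / ennreal w0"
      using bound[OF that] by (rule divide_right_mono_ennreal)
    also have "\<dots> = ennreal (C * rate_fun u w f xd q \<delta> / w0)"
      using nonneg assms(5) by (rule divide_ennreal)
    finally have "ennreal_powr (R_qw u w q (x - xd) / ennreal w0) (1 / q)
        \<le> ennreal ((C * rate_fun u w f xd q \<delta> / w0) powr (1 / q))"
      using nonneg assms(5,8) by (intro ennreal_powr_le) auto
    \<comment> \<open>Regrouping lets the power split off the constant
      \<open>(C / w0) powr (1 / q)\<close>.\<close>
    moreover have "C * rate_fun u w f xd q \<delta> / w0 = C / w0 * rate_fun u w f xd q \<delta>" by simp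
    ultimately show ?thesis by (simp only: powr_mult)
  qed
  have pos: "\<forall>\<^sub>F \<delta>::real in at_right 0. 0 < \<delta>"
    by (rule eventually_at_right_less)
  \<comment> \<open>At least two weights, each no smaller than \<open>w0\<close>, sum to more than
    \<open>w0\<close>. An infinite support is excluded because its \<open>card\<close> is 0.\<close>
  have weights: "1 < 1 / w0 * (\<Sum>k\<in>supp u xd. w k)" if "1 < card (supp u xd)"
  proof -
    have "1 * w0 < of_nat (card (supp u xd)) * w0"
      using that assms(5) by (intro mult_strict_right_mono) auto
    also have "\<dots> \<le> (\<Sum>k\<in>supp u xd. w k)"
      using assms(6) supp_ge_1 by (intro sum_bounded_below) auto
    finally show ?thesis using assms(5) by (simp add: field_simps)
  qed
  show ?thesis
  proof (intro conjI impI ballI allI)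
    show "\<exists>C. \<forall>\<^sub>F \<delta> in at_right 0. \<forall>x\<in>sdp_solutions A u w p q \<theta> \<alpha>0 \<tau> y \<delta>.
        R_qw u w q (x - xd) \<le> ennreal (C * rate_fun u w f xd q \<delta>)"
      using pos bound by (auto intro!: exI[of _ C] elim!: eventually_mono)
    show "\<exists>C. \<forall>\<^sub>F \<delta> in at_right 0. \<forall>x\<in>sdp_solutions A u w p q \<theta> \<alpha>0 \<tau> y \<delta>.
        ennreal_powr (R_qw u w q (x - xd) / ennreal w0) (1 / q)
          \<le> ennreal (C * rate_fun u w f xd q \<delta> powr (1 / q))"
      using pos bound' by (auto intro!: exI[of _ "(C / w0) powr (1 / q)"] elim!: eventually_mono)
    show "filterlim (C_qw u w f xd) at_top (at_right 0)"
      if "1 < card (supp u xd) \<and> 1 < (\<Sum>k\<in>supp u xd. w k)"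
      using C_qw_at_top[of 1] that by simp
    show "filterlim (\<lambda>r. (1 / w0) powr (1 / r) * C_qw u w f xd r) at_top (at_right 0)"
      if "1 < card (supp u xd)"
      using C_qw_at_top[of "1 / w0"] weights[OF that] assms(5) by simp
  qed (use concave_on_rate index_function_rate norm_le_R_one[OF basis]
      R_one_le_R_qw[of w0 w q u] assms(5,6) q sparse_in_M_qw rate_fun_sparse in auto)
qed

end
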